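(* Let $f$ be a (single-valued or multi-valued) mapping acting in $\mathbb{R}^n$, and let the closed ball $B_r^{\mathbb{R}^n}(x_0)$ with center $x_0\in\mathbb{R}^n$ and radius $r>0$ be contained in the domain of $f$. Suppose $f(B_r^{\mathbb{R}^n}(x_0))\subseteq B_r^{\mathbb{R}^n}(x_0)$ and that for some linear subspace $\mathbb{R}^k$ of $\mathbb{R}^n$ of dimension $k$, $1\le k\le n$, one has $f(B_r^{\mathbb{R}^n}(x_0)\cap\mathbb{R}^k)\subset B_r^{\mathbb{R}^n}(x_0)\cap\mathbb{R}^k$. Let $f_1(x)=x-f(x)$ for $x\in B_r^{\mathbb{R}^n}(x_0)$. If $f_1(B_r^{\mathbb{R}^n}(x_0))$ is a convex set, then $f$ has a fixed point in $B_r^{\mathbb{R}^n}(x_0)$, i.e. there is $x\in B_r^{\mathbb{R}^n}(x_0)$ with $f(x)=x$ ($x\in f(x)$ if $f$ is multi-valued).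
   Context: No continuity of $f$ is assumed. A multi-valued mapping assigns to each point $x$ of its domain a nonempty subset $f(x)$; $f(G)=\bigcup_{x\in G}f(x)$ and $x-f(x)=\{x-y:y\in f(x)\}$. The symbol $\subset$ denotes (not necessarily proper) inclusion. *)

theory Defs
  imports "HOL-Analysis.Analysis"
begin

text \<open>
  A multi-valued mapping with domain \<open>D\<close> is a set-valued function whose values on \<open>D\<close> are
  nonempty; its values outside \<open>D\<close> are irrelevant.
\<close>

definition multimap_on :: "'a set \<Rightarrow> ('a \<Rightarrow> 'b set) \<Rightarrow> bool"
  where "multimap_on D F \<longleftrightarrow> (\<forall>x\<in>D. F x \<noteq> {})"

definition multi_image :: "('a \<Rightarrow> 'b set) \<Rightarrow> 'a set \<Rightarrow> 'b set"
  where "multi_image F G = (\<Union>x\<in>G. F x)"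

definition multi_displacement :: "('a::minus \<Rightarrow> 'a set) \<Rightarrow> 'a \<Rightarrow> 'a set"
  where "multi_displacement F x = {x - y | y. y \<in> F x}"

end

theory Submission
  imports Defs
begin

text \<open>
  If the convex set of displacements missed \<open>0\<close>, a nonzero \<open>a\<close> would satisfy \<open>a \<bullet> (x - y) \<ge> 0\<close>
  for all \<open>x\<close> in the ball and \<open>y \<in> F x\<close>. At the point \<open>x\<close> of the ball minimising \<open>a \<bullet> x\<close> this forces
  \<open>y = x\<close>, because the minimiser of a linear functional over a Euclidean ball is unique.
  No continuity is involved, and the weak separation available in finite dimension suffices.
\<close>

text \<open>This is the equality case of Cauchy-Schwarz. For \<open>u = x0 - y\<close> the
  hypotheses give the chain \<open>r * norm a\<close> \<le> \<open>a \<bullet> u\<close> \<le>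
  \<open>norm a * norm u\<close> \<le> \<open>r * norm a\<close>, so \<open>u\<close> has length
  \<open>r\<close> and points along \<open>a\<close>.\<close>

lemma cball_linear_minimizer_unique:
  fixes a y x0 :: "'a::real_inner"
  assumes "a \<noteq> 0" and y: "y \<in> cball x0 r"
    and le: "a \<bullet> y \<le> a \<bullet> (x0 - (r / norm a) *\<^sub>R a)"
  shows "y = x0 - (r / norm a) *\<^sub>R a"
proof -
  define u where "u = x0 - y"
  have "norm a > 0" using \<open>a \<noteq> 0\<close> by simp
  have r: "norm u \<le> r" using y by (simp add: u_def dist_norm)
  have aa: "(r / norm a) * (a \<bullet> a) = r * norm a"
    using \<open>norm a > 0\<close> by (simp add: dot_square_norm power2_eq_square)
  then have ge: "r * norm a \<le> a \<bullet> u"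
    using le by (simp add: u_def inner_diff_right)
  have "r * norm a \<le> norm u * norm a"
    using ge norm_cauchy_schwarz[of a u] by (simp add: mult.commute)
  then have nu: "norm u = r" using r \<open>norm a > 0\<close> by simp
  then have "a \<bullet> u = norm a * norm u"
    using ge norm_cauchy_schwarz[of a u] by (simp add: mult.commute)
  \<comment> \<open>Equality in Cauchy-Schwarz makes \<open>u\<close> and \<open>a\<close> parallel
    with the same direction.\<close>
  then have "norm a *\<^sub>R u = r *\<^sub>R a"
    using nu norm_cauchy_schwarz_eq[of a u] by simp
  then have "u = (r / norm a) *\<^sub>R a"
    using \<open>norm a > 0\<close> by (metis divide_inverse_commute less_irrefl scaleR_left_imp_eq
        scaleR_scaleR scaleR_one right_inverse)
  then show ?thesis by (simp add: u_def algebra_simps)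
qed

lemma multimap_fixpoint_convex_displacement:
  fixes x0 :: "'a::euclidean_space"
  assumes "r \<ge> 0" and ne: "multimap_on (cball x0 r) F"
    and sub: "multi_image F (cball x0 r) \<subseteq> cball x0 r"
    and conv: "convex (multi_image (multi_displacement F) (cball x0 r))"
  shows "\<exists>x\<in>cball x0 r. x \<in> F x"
proof (cases "0 \<in> multi_image (multi_displacement F) (cball x0 r)")
  case True
  then show ?thesis by (auto simp: multi_image_def multi_displacement_def)
next
  case False
  then obtain a where "a \<noteq> 0"
    and a: "\<And>z. z \<in> multi_image (multi_displacement F) (cball x0 r) \<Longrightarrow> 0 \<le> a \<bullet> z"
    using separating_hyperplane_set_0[OF conv] by blast
  \<comment> \<open>The minimiser of \<open>a \<bullet> x\<close> over the ball: go from the centre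
    a distance \<open>r\<close> in the direction opposite to \<open>a\<close>.\<close>
  define x where "x = x0 - (r / norm a) *\<^sub>R a"
  have x: "x \<in> cball x0 r"
    using \<open>a \<noteq> 0\<close> \<open>r \<ge> 0\<close> by (simp add: x_def dist_norm)
  then obtain y where y: "y \<in> F x" using ne unfolding multimap_on_def by blast
  have "y \<in> cball x0 r" using sub x y unfolding multi_image_def by blast
  \<comment> \<open>Separation applied to this displacement shows that \<open>y\<close> attains the
    minimum too.\<close>
  moreover have "x - y \<in> multi_image (multi_displacement F) (cball x0 r)"
    using x y by (auto simp: multi_image_def multi_displacement_def)
  from a[OF this] have "a \<bullet> y \<le> a \<bullet> x" by (simp add: inner_diff_right)
  ultimately have "y = x"
    using cball_linear_minimizer_unique \<open>a \<noteq> 0\<close> unfolding x_def by blast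
  then show ?thesis using x y by blast
qed

theorem theorem7:
  fixes x0 :: "real ^ 'n" and r :: real and k :: nat
    and S D :: "(real ^ 'n) set"
    and F :: "real ^ 'n \<Rightarrow> (real ^ 'n) set"
    and g :: "real ^ 'n \<Rightarrow> real ^ 'n"
  assumes "r > 0"
    and "cball x0 r \<subseteq> D"
    and "subspace S" and "dim S = k" and "1 \<le> k" and "k \<le> CARD('n)"
  shows "(multimap_on D F \<longrightarrow>
          multi_image F (cball x0 r) \<subseteq> cball x0 r \<longrightarrow>
          multi_image F (cball x0 r \<inter> S) \<subseteq> cball x0 r \<inter> S \<longrightarrow>
          convex (multi_image (multi_displacement F) (cball x0 r)) \<longrightarrow>
          (\<exists>x\<in>cball x0 r. x \<in> F x))
       \<and> (g ` cball x0 r \<subseteq> cball x0 r \<longrightarrow>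
          g ` (cball x0 r \<inter> S) \<subseteq> cball x0 r \<inter> S \<longrightarrow>
          convex ((\<lambda>x. x - g x) ` cball x0 r) \<longrightarrow>
          (\<exists>x\<in>cball x0 r. g x = x))"
proof (intro conjI impI)
  assume "multimap_on D F" and "multi_image F (cball x0 r) \<subseteq> cball x0 r"
    and "convex (multi_image (multi_displacement F) (cball x0 r))"
  then show "\<exists>x\<in>cball x0 r. x \<in> F x"
    using multimap_fixpoint_convex_displacement[of r x0 F] assms(1,2)
    by (simp add: multimap_on_def subset_iff)
next
  assume "g ` cball x0 r \<subseteq> cball x0 r" and "convex ((\<lambda>x. x - g x) ` cball x0 r)"
  \<comment> \<open>A single-valued \<open>g\<close> is treated as the multi-valued map with
    singleton values.\<close>
  moreover have "multi_image (\<lambda>x. {g x}) (cball x0 r) = g ` cball x0 r"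
    and "multi_image (multi_displacement (\<lambda>x. {g x})) (cball x0 r) = (\<lambda>x. x - g x) ` cball x0 r"
    by (auto simp: multi_image_def multi_displacement_def)
  ultimately have "\<exists>x\<in>cball x0 r. x \<in> {g x}"
    using assms(1) by (intro multimap_fixpoint_convex_displacement) (simp_all add: multimap_on_def)
  then show "\<exists>x\<in>cball x0 r. g x = x" by (metis singletonD)
qed

end
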